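(* Consider a radial flow network with finite connected graph of permissible edges $\mathcal{G}=(\mathcal{V},\mathcal{E})$ and operational spanning tree $\mathcal{T}=(\mathcal{V},\mathcal{E}_{\mathcal{T}})$, $\mathcal{E}_{\mathcal{T}}\subset\mathcal{E}$, with strictly increasing flow functions and independent injections at non-reference nodes, each having a probability density, such that all nodal potentials $\pi_a$ have finite variance. Give each permissible edge $(ab)\in\mathcal{E}$ the weight $$\phi_{ab}=\mathbb{E}\big[\big(\pi_a-\pi_b-(\mu_{\pi_a}-\mu_{\pi_b})\big)^2\big],\qquad \mu_{\pi_a}=\mathbb{E}[\pi_a].$$ Then $\mathcal{E}_{\mathcal{T}}$ is the edge set of the (unique) minimum-weight spanning tree of $\mathcal{G}$ with respect to the weights $\phi_{ab}$.
   Context: Radial flow network: $\mathcal{G}=(\mathcal{V},\mathcal{E})$ is a finite simple connected graph (nodes and permissible edges) and $\mathcal{T}$ is a spanning tree of $\mathcal{G}$ with edge set $\mathcal{E}_{\mathcal{T}}$ (the operational edges). One node of $\mathcal{V}$ is distinguished as the reference node. All edges of $\mathcal{T}$ are directed towards the reference node: an operational edge is written $(ab)$ with $b$ the parent of $a$, i.e. $b$ is the neighbour of $a$ on the unique path in $\mathcal{T}$ from $a$ to the reference node. Injections: each non-reference node $a$ has a real random injection $P_a$; the injections at non-reference nodes are mutually independent and each has a probability density function. The injection at the reference node is minus the sum of all the others. Flows: $f_{ab}$ is the flow from $a$ to $b$ on the edge $(ab)$, with $f_{ba}=-f_{ab}$. Flow is conserved at every node: $P_a=\sum_{b:\,a,b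 \text{ adjacent in } \mathcal{T}} f_{ab}$. These equations determine the flows from the injections. Potentials: every operational edge $(ab)$ (with $b$ the parent of $a$) has a strictly increasing flow function $g_{ab}:\mathbb{R}\to\mathbb{R}$, possibly nonlinear and possibly different for each edge, and the nodal potentials $\pi_a$ satisfy $\pi_a-\pi_b=g_{ab}(f_{ab})$. The potential at the reference node is a fixed constant (potentials are measured relative to it). All potentials are assumed to have finite variance. *)

theory Defs
  imports "HOL-Probability.Probability" "Graph_Theory.Digraph_Component"
begin

text \<open>
  A finite simple graph is a \<^locale>\<open>pair_graph\<close>: a finite, symmetric, loop-free set of arcs,
  each undirected edge being represented by its two arcs.

  The library's \<open>tree\<close> and \<open>spanning_tree\<close> are unsuitable for symmetric digraphs, since there
  \<open>a, b, a\<close> counts as a cycle. In a simple graph the cycles in the undirected sense are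
  exactly those of length at least 3. The name \<open>connected\<close> is qualified because topological
  connectedness has the same base name.
\<close>

definition undirected_tree :: "'v pair_pre_digraph \<Rightarrow> bool" where
  "undirected_tree H \<longleftrightarrow>
     pair_graph H \<and> Digraph_Component.connected (with_proj H) \<and>
     \<not> (\<exists>p. pre_digraph.cycle (with_proj H) p \<and> 3 \<le> length p)"

definition undirected_spanning_tree :: "'v pair_pre_digraph \<Rightarrow> 'v pair_pre_digraph \<Rightarrow> bool" where
  "undirected_spanning_tree H G \<longleftrightarrow> undirected_tree H \<and> spanning (with_proj H) (with_proj G)"

text \<open>
  The factor \<open>1/2\<close> compensates for each undirected edge occurring as two arcs; this is meant for
  weights with \<open>w (a, b) = w (b, a)\<close>.
\<close>

definition total_weight :: "('v \<times> 'v \<Rightarrow> real) \<Rightarrow> 'v pair_pre_digraph \<Rightarrow> real" where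
  "total_weight w H = (\<Sum>e\<in>parcs H. w e) / 2"

definition minimum_spanning_tree ::
  "('v \<times> 'v \<Rightarrow> real) \<Rightarrow> 'v pair_pre_digraph \<Rightarrow> 'v pair_pre_digraph \<Rightarrow> bool" where
  "minimum_spanning_tree w G H \<longleftrightarrow>
     undirected_spanning_tree H G \<and>
     (\<forall>H'. undirected_spanning_tree H' G \<longrightarrow> total_weight w H \<le> total_weight w H')"

text \<open>
  The edges of a tree directed towards the node \<open>r\<close>: \<open>(a, b)\<close> belongs to this set iff it is the
  first step of the (in a tree, unique) path from \<open>a\<close> to \<open>r\<close>, that is, iff \<open>b\<close> is the parent
  of \<open>a\<close>.
\<close>

definition arcs_towards :: "'v pair_pre_digraph \<Rightarrow> 'v \<Rightarrow> ('v \<times> 'v) set" where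
  "arcs_towards H r = {(a, b). \<exists>p. pre_digraph.apath (with_proj H) a ((a, b) # p) r}"

text \<open>
  \<open>G\<close> is the graph of permissible edges, \<open>T\<close> the operational tree, \<open>r\<close> the reference node.
  \<open>P a\<close> is the injection at \<open>a\<close>, \<open>f a b\<close> the flow from \<open>a\<close> to \<open>b\<close>, \<open>g a b\<close> the flow function
  of the edge from \<open>a\<close> to its parent \<open>b\<close>, \<open>pot a\<close> the potential at \<open>a\<close>, and \<open>c\<close> the potential
  at the reference node. Measurability of flows and of potentials follows from that of the
  injections, which is part of \<^const>\<open>distributed\<close>.
\<close>

locale radial_flow_network = prob_space M + pair_graph G
  for M :: "'w measure" and G :: "'v pair_pre_digraph" +
  fixes T :: "'v pair_pre_digraph" and r :: 'v
    and P :: "'v \<Rightarrow> 'w \<Rightarrow> real"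
    and f :: "'v \<Rightarrow> 'v \<Rightarrow> 'w \<Rightarrow> real"
    and g :: "'v \<Rightarrow> 'v \<Rightarrow> real \<Rightarrow> real"
    and pot :: "'v \<Rightarrow> 'w \<Rightarrow> real"
    and c :: real
  assumes graph_connected: "Digraph_Component.connected (with_proj G)"
    and operational_tree: "undirected_spanning_tree T G"
    and reference_node: "r \<in> pverts G"
    and injections_indep: "indep_vars (\<lambda>_. borel) P (pverts G - {r})"
    and injections_density: "\<And>a. a \<in> pverts G - {r} \<Longrightarrow> \<exists>d. distributed M lborel (P a) d"
    and injection_reference:
      "\<And>\<omega>. \<omega> \<in> space M \<Longrightarrow> P r \<omega> = - (\<Sum>a\<in>pverts G - {r}. P a \<omega>)"
    and flow_antisym:
      "\<And>a b \<omega>. (a, b) \<in> parcs T \<Longrightarrow> \<omega> \<in> space M \<Longrightarrow> f b a \<omega> = - f a b \<omega>"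
    and flow_conservation:
      "\<And>a \<omega>. a \<in> pverts G \<Longrightarrow> \<omega> \<in> space M \<Longrightarrow> P a \<omega> = (\<Sum>b | (a, b) \<in> parcs T. f a b \<omega>)"
    and flow_function_strict_mono: "\<And>a b. (a, b) \<in> arcs_towards T r \<Longrightarrow> strict_mono (g a b)"
    and potential_difference:
      "\<And>a b \<omega>. (a, b) \<in> arcs_towards T r \<Longrightarrow> \<omega> \<in> space M \<Longrightarrow>
         pot a \<omega> - pot b \<omega> = g a b (f a b \<omega>)"
    and potential_reference: "\<And>\<omega>. \<omega> \<in> space M \<Longrightarrow> pot r \<omega> = c"
    and potential_finite_mean: "\<And>a. a \<in> pverts G \<Longrightarrow> integrable M (pot a)"
    and potential_finite_variance:
      "\<And>a. a \<in> pverts G \<Longrightarrow> integrable M (\<lambda>\<omega>. (pot a \<omega> - expectation (pot a))\<^sup>2)"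

definition (in prob_space) potential_weight :: "('v \<Rightarrow> 'a \<Rightarrow> real) \<Rightarrow> 'v \<times> 'v \<Rightarrow> real" where
  "potential_weight pot = (\<lambda>(a, b).
     expectation (\<lambda>\<omega>. (pot a \<omega> - pot b \<omega> - (expectation (pot a) - expectation (pot b)))\<^sup>2))"

end

theory Submission
  imports Defs
begin

text \<open>
  Deleting an operational edge splits the tree in two. By conservation, the flow over the edge is
  the sum of the injections on the side away from the reference node, so every potential drop
  from a node to its parent is an increasing function of a sum of independent injections over a subtree.
  Two facts about these drops decide everything.

  Consider two edges of a path in the tree, both drops taken in the direction of travel. If the
  path traverses both edges towards the reference node, or both away from it, their subtrees are
  nested, say \<open>A \<subseteq> B\<close>, and up to a common sign the drops are increasing functions of \<open>S\<close> and
  \<open>S + R\<close>, where \<open>S\<close> sums over \<open>A\<close> and the independent \<open>R\<close> sums over \<open>B - A\<close>; Chebyshev's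
  association inequality (\<open>expectation_mult_mono_ge\<close>) makes their covariance nonnegative. If one
  edge leads towards the reference node and the other away from it, the subtrees are disjoint and
  the drops are independent. So the covariance is never negative (\<open>drop_cov_nested_nonneg\<close>), and the
  variance of the potential difference of two nodes is at least the sum of the variances of the
  drops along the tree path that joins them (\<open>path_weight_le_potential_weight\<close>).

  Each single drop has positive variance, because a sum of independent variables one of which has
  a density has no atoms and a strictly increasing function keeps it nonconstant
  (\<open>drop_variance_pos\<close>). Hence a permissible edge between the two sides of an operational edge,
  other than this edge itself, is strictly heavier: its tree path uses the operational edge and
  at least one further edge (\<open>potential_weight_strict_cut\<close>).

  The rest is the exchange argument for spanning trees, carried out among all connected
  spanning subgraphs instead of spanning trees only. Any of these other than the operational tree
  either contains the tree properly, and then a lighter one is obtained by dropping edges, or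
  misses a tree edge, and then an edge that crosses the corresponding cut can be exchanged for it
  (\<open>cheaper_connected_spanning_subgraph\<close>). There are finitely many, so the tree is the only
  lightest one. The larger class makes the exchange step a matter of connectedness alone.
\<close>

section \<open>Association of monotone functions of independent sums\<close>

text \<open>
  The threshold \<open>t\<close> is a point where \<open>g\<close> crosses the level \<open>m\<close>. That it lies between the
  two given points is what later transfers integrability from them to \<open>t\<close>.
\<close>

lemma mono_threshold:
  fixes g :: "real \<Rightarrow> real"
  assumes "mono g" "g s1 \<le> m" "m \<le> g s2"
  obtains t where "min s1 s2 \<le> t" "t \<le> max s1 s2"
    and "\<And>s. s < t \<Longrightarrow> g s \<le> m" "\<And>s. t < s \<Longrightarrow> m \<le> g s"
proof (cases "s1 \<le> s2")
  case True
  define A where "A = {s. s \<le> s2 \<and> g s \<le> m}"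
  have bdd: "bdd_above A"
    by (auto simp: A_def bdd_above_def)
  have s1: "s1 \<in> A"
    using True assms by (simp add: A_def)
  have above: "m \<le> g s" if "Sup A < s" for s
  proof (cases "s \<le> s2")
    case True
    have "s \<notin> A"
      using cSup_upper[OF _ bdd, of s] that by auto
    with True show ?thesis
      by (simp add: A_def)
  next
    case False
    then show ?thesis
      using monoD[OF assms(1), of s2 s] assms(3) by simp
  qed
  have below: "g s \<le> m" if "s < Sup A" for s
  proof -
    obtain x where "x \<in> A" "s < x"
      using less_cSup_iff[of A s] bdd s1 \<open>s < Sup A\<close> by auto
    then show ?thesis
      using monoD[OF assms(1), of s x] by (simp add: A_def)
  qed
  have "s1 \<le> Sup A"
    using s1 bdd by (rule cSup_upper)
  moreover have "Sup A \<le> s2"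
    using s1 by (intro cSup_least) (auto simp: A_def)
  ultimately show thesis
    using that[of "Sup A"] above below True by simp
next
  case False
  then have "g s2 \<le> g s1"
    using monoD[OF assms(1), of s2 s1] by simp
  then have "g s1 = m"
    using assms by simp
  then show thesis
    using that[of s1] False monoD[OF assms(1)] by fastforce
qed

context prob_space
begin

lemma integrable_mult_of_square:
  fixes X Y :: "'a \<Rightarrow> real"
  assumes [measurable]: "random_variable borel X" "random_variable borel Y"
    and "integrable M (\<lambda>\<omega>. (X \<omega>)\<^sup>2)" "integrable M (\<lambda>\<omega>. (Y \<omega>)\<^sup>2)"
  shows "integrable M (\<lambda>\<omega>. X \<omega> * Y \<omega>)"
proof (rule Bochner_Integration.integrable_bound)
  show "integrable M (\<lambda>\<omega>. (X \<omega>)\<^sup>2 + (Y \<omega>)\<^sup>2)"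
    using assms by simp
  have "\<bar>x * y\<bar> \<le> x\<^sup>2 + y\<^sup>2" for x y :: real
  proof -
    have "2 * \<bar>x * y\<bar> \<le> x\<^sup>2 + y\<^sup>2"
      using zero_le_power2[of "\<bar>x\<bar> - \<bar>y\<bar>"] by (simp add: power2_diff abs_mult)
    then show ?thesis
      using abs_ge_zero[of "x * y"] by linarith
  qed
  then show "AE \<omega> in M. norm (X \<omega> * Y \<omega>) \<le> norm ((X \<omega>)\<^sup>2 + (Y \<omega>)\<^sup>2)"
    by simp
qed simp

lemma exists_le_expectation:
  fixes X :: "'a \<Rightarrow> real"
  assumes "integrable M X" "AE \<omega> in M. Q \<omega>"
  obtains \<omega> where "\<omega> \<in> space M" "Q \<omega>" "X \<omega> \<le> expectation X"
proof (rule ccontr)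
  assume "\<not> thesis"
  then have *: "expectation X < X \<omega>" if "\<omega> \<in> space M" "Q \<omega>" for \<omega>
    using that \<open>\<And>\<omega>. \<omega> \<in> space M \<Longrightarrow> Q \<omega> \<Longrightarrow> X \<omega> \<le> expectation X \<Longrightarrow> thesis\<close> by force
  have "AE \<omega> in M. expectation X < X \<omega>"
    using assms(2) AE_space[of M] by eventually_elim (rule *)
  then have "expectation (\<lambda>_. expectation X) < expectation X"
    using assms(1) by (intro integral_less_AE_space) (auto simp: emeasure_space_1)
  then show False
    by (simp add: prob_space)
qed

lemma exists_ge_expectation:
  fixes X :: "'a \<Rightarrow> real"
  assumes "integrable M X" "AE \<omega> in M. Q \<omega>"
  obtains \<omega> where "\<omega> \<in> space M" "Q \<omega>" "expectation X \<le> X \<omega>"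
  using exists_le_expectation[of "\<lambda>\<omega>. - X \<omega>" Q] assms by auto

text \<open>
  Fubini: \<open>h\<close> is integrable for the product of the laws of \<open>S\<close> and \<open>R\<close>, hence almost all its
  sections are.
\<close>

lemma AE_integrable_translate:
  fixes S R :: "'a \<Rightarrow> real" and h :: "real \<Rightarrow> real"
  assumes indep: "indep_var borel S borel R" and [measurable]: "h \<in> borel_measurable borel"
    and int: "integrable M (\<lambda>\<omega>. h (S \<omega> + R \<omega>))"
  shows "AE \<omega> in M. integrable M (\<lambda>\<omega>'. h (S \<omega> + R \<omega>'))"
proof -
  have S [measurable]: "random_variable borel S" and R [measurable]: "random_variable borel R"
    and joint: "distr M borel S \<Otimes>\<^sub>M distr M borel R =
      distr M (borel \<Otimes>\<^sub>M borel) (\<lambda>\<omega>. (S \<omega>, R \<omega>))"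
    using indep unfolding indep_var_distribution_eq by auto
  interpret D: prob_space "distr M borel S" by (rule prob_space_distr) simp
  interpret E: prob_space "distr M borel R" by (rule prob_space_distr) simp
  interpret pair_prob_space "distr M borel S" "distr M borel R" ..
  have "integrable (distr M borel S \<Otimes>\<^sub>M distr M borel R) (\<lambda>(s, t). h (s + t))"
    unfolding joint using int by (subst integrable_distr_eq) (auto simp: split_beta)
  then have "AE s in distr M borel S. integrable (distr M borel R) (\<lambda>t. h (s + t))"
    by (rule AE_integrable_fst)
  then have "AE s in distr M borel S. integrable M (\<lambda>\<omega>'. h (s + R \<omega>'))"
    by (subst (asm) integrable_distr_eq) auto
  then show ?thesis
    by (rule AE_distrD[rotated]) simp
qed

text \<open>
  Chebyshev's association inequality for \<open>g(S)\<close> and \<open>h(S + R)\<close>. Let \<open>m\<close> be the mean of \<open>g(S)\<close>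
  and \<open>t\<close> a point where \<open>g\<close> crosses \<open>m\<close>. The factors \<open>g(S) - m\<close> and \<open>h(S + R) - h(t + R)\<close>
  never have opposite signs, and \<open>g(S) - m\<close> is uncorrelated with \<open>h(t + R)\<close> by independence, so
  \<open>g(S) - m\<close> has nonnegative correlation with \<open>h(S + R)\<close>.

  The point that needs care is that \<open>h(t + R)\<close> be integrable, which Fubini gives for almost every
  value of \<open>S\<close> in place of \<open>t\<close>, not for all. Some of these values satisfy \<open>g(S) \<le> m\<close> and
  some \<open>g(S) \<ge> m\<close>, and \<open>h(t + R)\<close> is squeezed between the two translates of \<open>h\<close> for such a pair.
\<close>

lemma expectation_mult_mono_ge:
  fixes S R :: "'a \<Rightarrow> real" and g h :: "real \<Rightarrow> real"
  assumes indep: "indep_var borel S borel R"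
    and g: "mono g" and h: "mono h"
    and int_g: "integrable M (\<lambda>\<omega>. g (S \<omega>))" and int_h: "integrable M (\<lambda>\<omega>. h (S \<omega> + R \<omega>))"
    and int_gh: "integrable M (\<lambda>\<omega>. g (S \<omega>) * h (S \<omega> + R \<omega>))"
  shows "expectation (\<lambda>\<omega>. g (S \<omega>)) * expectation (\<lambda>\<omega>. h (S \<omega> + R \<omega>))
    \<le> expectation (\<lambda>\<omega>. g (S \<omega>) * h (S \<omega> + R \<omega>))"
proof -
  have g_meas [measurable]: "g \<in> borel_measurable borel"
    and h_meas [measurable]: "h \<in> borel_measurable borel"
    using g h by (auto intro: borel_measurable_mono)
  have [measurable]: "random_variable borel S" "random_variable borel R"
    using indep indep_var_rv1 indep_var_rv2 by blast+
  define m where "m = expectation (\<lambda>\<omega>. g (S \<omega>))"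
  have AE_int: "AE \<omega> in M. integrable M (\<lambda>\<omega>'. h (S \<omega> + R \<omega>'))"
    using indep h_meas int_h by (rule AE_integrable_translate)
  obtain s1 where s1: "integrable M (\<lambda>\<omega>. h (s1 + R \<omega>))" "g s1 \<le> m"
    using exists_le_expectation[OF int_g AE_int] by (auto simp: m_def)
  obtain s2 where s2: "integrable M (\<lambda>\<omega>. h (s2 + R \<omega>))" "m \<le> g s2"
    using exists_ge_expectation[OF int_g AE_int] by (auto simp: m_def)
  obtain t where t: "min s1 s2 \<le> t" "t \<le> max s1 s2"
    and below: "\<And>s. s < t \<Longrightarrow> g s \<le> m" and above: "\<And>s. t < s \<Longrightarrow> m \<le> g s"
    using mono_threshold[OF g s1(2) s2(2)] by metis
  have int_t: "integrable M (\<lambda>\<omega>. h (t + R \<omega>))"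
  proof (rule Bochner_Integration.integrable_bound)
    show "integrable M (\<lambda>\<omega>. \<bar>h (s1 + R \<omega>)\<bar> + \<bar>h (s2 + R \<omega>)\<bar>)"
      using s1 s2 by simp
    have "h (min s1 s2 + x) \<le> h (t + x)" "h (t + x) \<le> h (max s1 s2 + x)" for x
      using t by (auto intro!: monoD[OF h])
    then have "\<bar>h (t + x)\<bar> \<le> \<bar>h (s1 + x)\<bar> + \<bar>h (s2 + x)\<bar>" for x
      by (smt (verit) max_def min_def)
    then show "AE \<omega> in M. norm (h (t + R \<omega>)) \<le> norm (\<bar>h (s1 + R \<omega>)\<bar> + \<bar>h (s2 + R \<omega>)\<bar>)"
      by simp
  qed simp
  have indep_t: "indep_var borel (\<lambda>\<omega>. g (S \<omega>) - m) borel (\<lambda>\<omega>. h (t + R \<omega>))"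
    using indep_var_compose[OF indep, of "\<lambda>s. g s - m" borel "\<lambda>x. h (t + x)" borel]
    by (simp add: comp_def)
  have int_gm: "integrable M (\<lambda>\<omega>. g (S \<omega>) - m)"
    using int_g by simp
  have mean_0: "expectation (\<lambda>\<omega>. g (S \<omega>) - m) = 0"
    using int_g by (simp add: m_def prob_space)
  have int_prod: "integrable M (\<lambda>\<omega>. (g (S \<omega>) - m) * h (t + R \<omega>))"
    using indep_var_integrable[OF indep_t int_gm int_t] .
  have int_cov: "integrable M (\<lambda>\<omega>. (g (S \<omega>) - m) * h (S \<omega> + R \<omega>))"
    using int_gh int_h by (simp add: algebra_simps)
  have "0 = expectation (\<lambda>\<omega>. (g (S \<omega>) - m) * h (t + R \<omega>))"
    using indep_var_lebesgue_integral[OF indep_t int_gm int_t] mean_0 by simp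
  also have "\<dots> \<le> expectation (\<lambda>\<omega>. (g (S \<omega>) - m) * h (S \<omega> + R \<omega>))"
  proof (rule integral_mono[OF int_prod int_cov])
    fix \<omega>
    consider "S \<omega> < t" | "S \<omega> = t" | "t < S \<omega>"
      by linarith
    then show "(g (S \<omega>) - m) * h (t + R \<omega>) \<le> (g (S \<omega>) - m) * h (S \<omega> + R \<omega>)"
      using below[of "S \<omega>"] above[of "S \<omega>"]
        monoD[OF h, of "t + R \<omega>" "S \<omega> + R \<omega>"] monoD[OF h, of "S \<omega> + R \<omega>" "t + R \<omega>"]
      by cases (auto intro: mult_left_mono mult_left_mono_neg)
  qed
  also have "\<dots> = expectation (\<lambda>\<omega>. g (S \<omega>) * h (S \<omega> + R \<omega>)) - m * expectation (\<lambda>\<omega>. h (S \<omega> + R \<omega>))"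
    using int_gh int_h by (simp add: left_diff_distrib)
  finally show ?thesis
    by (simp add: m_def)
qed

text \<open>
  Given \<open>R\<close>, the sum can equal \<open>k\<close> only if \<open>S\<close> takes the single value \<open>k - R\<close>, which is a null
  event for a variable with a density.
\<close>

lemma AE_add_indep_neq:
  fixes S R :: "'a \<Rightarrow> real"
  assumes indep: "indep_var borel R borel S" and density: "distributed M lborel S d"
  shows "AE \<omega> in M. R \<omega> + S \<omega> \<noteq> k"
proof -
  have [measurable]: "random_variable borel S" "random_variable borel R"
    and joint: "distr M borel R \<Otimes>\<^sub>M distr M borel S =
      distr M (borel \<Otimes>\<^sub>M borel) (\<lambda>\<omega>. (R \<omega>, S \<omega>))"
    using indep unfolding indep_var_distribution_eq by auto
  interpret D: prob_space "distr M borel S" by (rule prob_space_distr) simp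
  interpret E: prob_space "distr M borel R" by (rule prob_space_distr) simp
  interpret pair_prob_space "distr M borel R" "distr M borel S" ..
  have *: "AE s in distr M lborel S. s \<noteq> c" for c
    unfolding distributed_distr_eq_density[OF density]
    using distributed_borel_measurable[OF density] AE_lborel_singleton[of c]
    by (subst AE_density) auto
  have borel: "distr M borel S = distr M lborel S"
    by (rule distr_cong) auto
  have "AE s in distr M borel S. r + s \<noteq> k" for r
    unfolding borel using *[of "k - r"] by (simp add: eq_diff_eq add.commute)
  moreover have "{z \<in> space (borel \<Otimes>\<^sub>M borel). fst z + snd z \<noteq> k} \<in> sets (borel \<Otimes>\<^sub>M borel)"
    by measurable
  ultimately have "AE z in distr M borel R \<Otimes>\<^sub>M distr M borel S. fst z + snd z \<noteq> k"
    by (intro AE_pair_measure) (simp_all add: space_pair_measure)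
  then show ?thesis
    unfolding joint by (subst (asm) AE_distr_iff) auto
qed

lemma variance_inj_atomless_pos:
  fixes X :: "'a \<Rightarrow> real" and g :: "real \<Rightarrow> real"
  assumes inj: "inj g" and atomless: "\<And>k. AE \<omega> in M. X \<omega> \<noteq> k"
    and int: "integrable M (\<lambda>\<omega>. (g (X \<omega>) - m)\<^sup>2)"
  shows "0 < expectation (\<lambda>\<omega>. (g (X \<omega>) - m)\<^sup>2)"
proof (rule ccontr)
  assume "\<not> ?thesis"
  then have "expectation (\<lambda>\<omega>. (g (X \<omega>) - m)\<^sup>2) = 0"
    by (simp add: order_antisym not_less)
  then have "AE \<omega> in M. g (X \<omega>) = m"
    using integral_nonneg_eq_0_iff_AE[OF int] by simp
  moreover have "AE \<omega> in M. X \<omega> \<noteq> inv g m"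
    by (rule atomless)
  ultimately have "AE \<omega> in M. False"
    by eventually_elim (use inj in auto)
  then show False
    by simp
qed

end

section \<open>The two sides of a tree edge\<close>

text \<open>
  The component of \<open>a\<close> after the edge between \<open>a\<close> and \<open>b\<close> is deleted. In a tree in which \<open>b\<close> is
  the parent of \<open>a\<close> these are \<open>a\<close> and its descendants; in the opposite case they are all nodes but
  \<open>b\<close> and its descendants. Not fixing the orientation allows paths to be treated uniformly,
  wherever the root lies.
\<close>

definition side :: "('v \<times> 'v) set \<Rightarrow> 'v \<Rightarrow> 'v \<Rightarrow> 'v set" where
  "side E a b = {v. (a, v) \<in> (E - {(a, b), (b, a)})\<^sup>*}"

lemma in_side_refl: "a \<in> side E a b"
  by (simp add: side_def)

lemma side_step:
  assumes "(u, v) \<in> E" "u \<in> side E a b" "(u, v) \<noteq> (a, b)" "(u, v) \<noteq> (b, a)"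
  shows "v \<in> side E a b"
  using assms unfolding side_def by (auto intro: rtrancl_into_rtrancl)

lemma (in pair_graph) apath_in_side:
  assumes "apath x p v" "a \<notin> set (awalk_verts x p)" "x \<in> side (parcs G) b a" "w \<in> set (awalk_verts x p)"
  shows "w \<in> side (parcs G) b a"
  using assms
proof (induction p arbitrary: x)
  case Nil
  then show ?case by simp
next
  case (Cons e p)
  obtain y where e: "e = (x, y)" "(x, y) \<in> parcs G" "apath y p v"
    using Cons.prems(1) by (cases e) (auto simp: apath_Cons_iff)
  have "y \<in> set (awalk_verts y p)"
    using e(3) hd_in_awalk_verts(2) by simp
  then have "y \<in> side (parcs G) b a"
    using side_step[OF e(2) Cons.prems(3)] Cons.prems(2) e(1) by auto
  then show ?case
    using Cons e in_side_refl by auto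
qed

text \<open>
  Some arc leaves \<open>A\<close> on the way from \<open>x\<close> to \<open>y\<close>. For the first such arc the part of the path
  before it stays in \<open>A\<close> and the part after it never returns to the arc's tail, so neither part
  uses the arc: its deletion leaves \<open>x\<close> joined to its tail and \<open>y\<close> to its head. This is what makes
  it exchangeable for an arc between \<open>x\<close> and \<open>y\<close>.
\<close>

lemma (in pair_graph) apath_crossing_arc:
  assumes "apath x p y" "x \<in> A" "y \<notin> A"
  obtains u v where "(u, v) \<in> parcs G" "u \<in> A" "v \<notin> A"
    "x \<in> side (parcs G) u v" "y \<in> side (parcs G) v u"
  using assms
proof (induction p arbitrary: x thesis)
  case Nil
  then show ?case by (simp add: apath_Nil_iff)
next
  case (Cons e p)
  obtain z where e: "e = (x, z)" "(x, z) \<in> parcs G" "apath z p y" "x \<notin> set (awalk_verts z p)"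
    using Cons.prems(2) by (cases e) (auto simp: apath_Cons_iff)
  show ?case
  proof (cases "z \<in> A")
    case True
    obtain u v where uv: "(u, v) \<in> parcs G" "u \<in> A" "v \<notin> A"
      "z \<in> side (parcs G) u v" "y \<in> side (parcs G) v u"
      using Cons.IH[OF _ e(3) True Cons.prems(4)] by blast
    have "(z, x) \<noteq> (u, v)" "(z, x) \<noteq> (v, u)"
      using True Cons.prems(3) uv(3) by auto
    then have "x \<in> side (parcs G) u v"
      using side_step[OF arcs_symmetric[OF e(2)] uv(4)] by simp
    then show ?thesis
      using Cons.prems(1) uv by blast
  next
    case False
    have "y \<in> set (awalk_verts z p)"
      using awlast_of_awalk[OF awalkI_apath[OF e(3)]] last_in_set[OF awalk_verts_non_Nil[of z p]]
      by (simp add: NOMATCH_def)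
    then have "y \<in> side (parcs G) z x"
      using apath_in_side[OF e(3,4) in_side_refl] by blast
    then show ?thesis
      by (rule Cons.prems(1)[OF e(2) Cons.prems(3) False in_side_refl])
  qed
qed

lemma (in pair_graph) rtrancl_imp_apath:
  assumes "(u, v) \<in> (parcs G)\<^sup>*" "u \<in> pverts G"
  obtains p where "apath u p v"
proof -
  have "(u, v) \<in> rtrancl_on (pverts G) (parcs G)"
    using assms
    by (induction rule: rtrancl_induct) (auto intro: rtrancl_on_into_rtrancl_on dest: in_arcsD1 in_arcsD2)
  then show thesis
    using that reachable_apath by (auto simp: reachable_def)
qed

text \<open>
  Acyclicity enters in the form that every edge is a bridge, from which the sides of an edge
  partition the nodes.
\<close>

locale simple_tree = pair_graph T for T :: "'v pair_pre_digraph" +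
  assumes tree_connected: "u \<in> pverts T \<Longrightarrow> v \<in> pverts T \<Longrightarrow> (u, v) \<in> (parcs T)\<^sup>*"
    and bridge: "(a, b) \<in> parcs T \<Longrightarrow> b \<notin> side (parcs T) a b"
begin

abbreviation tree_side where "tree_side \<equiv> side (parcs T)"

lemma side_subset_verts: "a \<in> pverts T \<Longrightarrow> tree_side a b \<subseteq> pverts T"
proof
  fix v assume "a \<in> pverts T" "v \<in> tree_side a b"
  then have "(a, v) \<in> (parcs T - {(a, b), (b, a)})\<^sup>*" "a \<in> pverts T"
    by (auto simp: side_def)
  then show "v \<in> pverts T"
    by (induction rule: rtrancl_induct) (auto dest: in_arcsD2)
qed

lemma leaving_side:
  assumes "(a, b) \<in> parcs T" "(u, v) \<in> parcs T" "u \<in> tree_side a b" "v \<notin> tree_side a b"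
  shows "u = a \<and> v = b"
  using assms side_step[of u v "parcs T" a b] bridge[of a b] by auto

lemma side_reverse:
  assumes "(a, b) \<in> parcs T"
  shows "tree_side b a = pverts T - tree_side a b"
proof -
  have b: "b \<in> pverts T" and a: "a \<in> pverts T"
    using assms by (auto dest: in_arcsD1 in_arcsD2)
  have "v \<notin> tree_side a b" if "v \<in> tree_side b a" for v
  proof
    assume "v \<in> tree_side a b"
    moreover have "sym (parcs T - {(a, b), (b, a)})"
      by (auto simp: sym_def arcs_symmetric)
    ultimately have "(v, b) \<in> (parcs T - {(a, b), (b, a)})\<^sup>*" "(a, v) \<in> (parcs T - {(a, b), (b, a)})\<^sup>*"
      using that by (auto simp: side_def insert_commute dest: sym_rtrancl symD)
    then have "b \<in> tree_side a b"
      unfolding side_def by (auto intro: rtrancl_trans)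
    with bridge assms show False
      by blast
  qed
  moreover have "v \<in> tree_side b a \<or> v \<in> tree_side a b" if "v \<in> pverts T" for v
    using tree_connected[OF a that]
  proof (induction rule: rtrancl_induct)
    case base
    then show ?case by (simp add: in_side_refl)
  next
    case (step u v)
    show ?case
    proof (cases "(u, v) = (a, b) \<or> (u, v) = (b, a)")
      case True
      then show ?thesis
        using in_side_refl[of a] in_side_refl[of b] by auto
    next
      case False
      then show ?thesis
        using step side_step[of u v "parcs T" a b] side_step[of u v "parcs T" b a] by auto
    qed
  qed
  ultimately show ?thesis
    using side_subset_verts[OF b] by auto
qed

text \<open>
  The node \<open>b\<close> lies on the far side of the first edge, and so does \<open>d\<close>. Thus the second edge has
  no end in \<open>tree_side a b\<close>, and this part of the tree survives its deletion in one piece, attached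
  to \<open>b\<close> through \<open>a\<close>.
\<close>

lemma side_nested:
  assumes ab: "(a, b) \<in> parcs T" and bd: "(b, d) \<in> parcs T" and "a \<noteq> d"
  shows "tree_side a b \<subseteq> tree_side b d"
proof
  fix x assume "x \<in> tree_side a b"
  have "d \<notin> tree_side a b"
    using leaving_side[OF ab arcs_symmetric[OF bd]] bridge[OF ab] assms(3) by auto
  have "a \<in> tree_side b d"
    using side_step[OF arcs_symmetric[OF ab], of b d] assms bd no_loops' by (auto simp: in_side_refl)
  have "(a, x) \<in> (parcs T - {(a, b), (b, a)})\<^sup>*"
    using \<open>x \<in> tree_side a b\<close> by (simp add: side_def)
  then have "x \<in> tree_side a b \<and> x \<in> tree_side b d"
  proof (induction rule: rtrancl_induct)
    case base
    then show ?case using \<open>a \<in> tree_side b d\<close> in_side_refl by auto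
  next
    case (step y z)
    then have "z \<in> tree_side a b"
      using side_step[of y z "parcs T" a b] by auto
    then show ?case
      using step side_step[of y z "parcs T" b d] \<open>d \<notin> tree_side a b\<close> bridge[OF ab] by auto
  qed
  then show "x \<in> tree_side b d" ..
qed

lemma apath_sides_increase:
  assumes "apath a ((a, b) # p) v" "(c, d) \<in> set p"
  shows "tree_side a b \<subseteq> tree_side c d"
  using assms
proof (induction p arbitrary: a b)
  case Nil
  then show ?case by simp
next
  case (Cons e p)
  obtain y where e: "e = (b, y)" and path: "apath b ((b, y) # p) v"
    using Cons.prems(1) by (cases e) (auto simp: apath_Cons_iff)
  have "y \<in> set (awalk_verts y p)"
    using path hd_in_awalk_verts(2) by (auto simp: apath_Cons_iff)
  then have "tree_side a b \<subseteq> tree_side b y"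
    using Cons.prems(1) path e by (intro side_nested) (auto simp: apath_Cons_iff)
  then show ?case
    using Cons.IH[OF path] Cons.prems(2) e by auto
qed

lemma crossing_arc_in_apath:
  assumes ab: "(a, b) \<in> parcs T" and "apath u p v" "u \<in> tree_side a b" "v \<notin> tree_side a b"
  shows "(a, b) \<in> set p"
  using assms(2-)
proof (induction p arbitrary: u)
  case Nil
  then show ?case by (simp add: apath_Nil_iff)
next
  case (Cons e p)
  obtain y where e: "e = (u, y)" "(u, y) \<in> parcs T" "apath y p v"
    using Cons.prems(1) by (cases e) (auto simp: apath_Cons_iff)
  then show ?case
    using Cons leaving_side[OF ab e(2)] by (cases "y \<in> tree_side a b") auto
qed

lemma exists_apath:
  assumes "u \<in> pverts T" "v \<in> pverts T"
  obtains p where "apath u p v"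
  using rtrancl_imp_apath[OF tree_connected[OF assms] assms(1)] by blast

text \<open>
  The side condition says that \<open>b\<close> is the parent of \<open>a\<close> when the tree is rooted at \<open>r\<close>: the path
  from \<open>a\<close> to \<open>r\<close> must cross from one side to the other, and a simple path can use an arc leaving
  its first node only as its first arc.
\<close>

lemma arc_towards:
  assumes ab: "(a, b) \<in> parcs T" and "r \<in> tree_side b a"
  shows "(a, b) \<in> arcs_towards T r"
proof -
  have "a \<in> pverts T" "b \<in> pverts T" and r: "r \<in> pverts T"
    using assms side_subset_verts[of b a] by (auto dest: in_arcsD1 in_arcsD2)
  obtain q where q: "apath a q r"
    using exists_apath[OF \<open>a \<in> _\<close> r] .
  have "r \<notin> tree_side a b"
    using side_reverse[OF ab] assms(2) by simp
  then have "(a, b) \<in> set q"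
    using crossing_arc_in_apath[OF ab q] by (simp add: in_side_refl)
  then obtain p where "q = (a, b) # p"
    using q by (cases q) (auto simp: apath_Cons_iff dest: awalk_verts_arc1)
  then show ?thesis
    using q unfolding arcs_towards_def by auto
qed

end

lemma connected_imp_rtrancl:
  assumes "pair_graph H" "Digraph_Component.connected (with_proj H)" "u \<in> pverts H" "v \<in> pverts H"
  shows "(u, v) \<in> (parcs H)\<^sup>*"
proof -
  interpret pair_graph H by fact
  have "strongly_connected (with_proj H)"
    using symmetric_connected_imp_strongly_connected[OF sym_arcs assms(2)] .
  then have "(u, v) \<in> rtrancl_on (pverts H) (parcs H)"
    using assms(3,4) by (auto simp: strongly_connected_def reachable_def)
  then show ?thesis
    by (rule rtrancl_on_rtranclI)
qed

text \<open>
  If \<open>b\<close> could be reached from \<open>a\<close> without the edge between them, a simple path doing so would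
  have at least two arcs and would close up with that edge to a cycle of length at least 3.
\<close>

lemma simple_tree_of_undirected_tree:
  assumes "undirected_tree H"
  shows "simple_tree H"
proof -
  have H: "pair_graph H" and conn: "Digraph_Component.connected (with_proj H)"
    and no_cycle: "\<And>p. pre_digraph.cycle (with_proj H) p \<Longrightarrow> length p < 3"
    using assms by (auto simp: undirected_tree_def not_le)
  interpret pair_graph H by fact
  have "b \<notin> side (parcs H) a b" if ab: "(a, b) \<in> parcs H" for a b
  proof
    assume "b \<in> side (parcs H) a b"
    \<comment> \<open>The graph without the edge, whose simple paths are simple paths of the original graph.\<close>
    define K where "K = \<lparr> pverts = pverts H, parcs = parcs H - {(a, b), (b, a)} \<rparr>"
    have parcs_K: "parcs K = parcs H - {(a, b), (b, a)}"
      by (simp add: K_def)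
    interpret K: pair_graph K
      using pair_finite_arcs pair_no_loops arcs_symmetric
      by unfold_locales (auto simp: K_def symmetric_def sym_def dest: in_arcsD1 in_arcsD2)
    have "(a, b) \<in> (parcs K)\<^sup>*" "a \<in> pverts K"
      using \<open>b \<in> side (parcs H) a b\<close> ab by (auto simp: side_def K_def dest: in_arcsD1)
    then obtain p where p: "K.apath a p b"
      using K.rtrancl_imp_apath by blast
    have "2 \<le> length p"
    proof (rule ccontr)
      assume "\<not> 2 \<le> length p"
      then consider "p = []" | e where "p = [e]"
        by (cases p rule: remdups_adj.cases) auto
      then show False
      proof cases
        case 1
        then have "a = b"
          using p by (simp add: K.apath_Nil_iff)
        then show False
          using no_loops'[OF ab] by simp
      next
        case 2
        then have "(a, b) \<in> parcs K"
          using p by (cases e) (simp add: K.apath_Cons_iff K.apath_Nil_iff)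
        then show False
          by (simp add: parcs_K)
      qed
    qed
    moreover have "cycle ((b, a) # p)"
    proof -
      have "awalk a p b"
        using K.awalkI_apath[OF p] \<open>a \<in> pverts K\<close> unfolding K.awalk_def awalk_def
        by (auto simp: K_def)
      then have "awalk b ((b, a) # p) b"
        using arcs_symmetric[OF ab] by (simp add: awalk_Cons_iff)
      then show ?thesis
        using p unfolding cycle_def K.apath_def by (intro exI[of _ b]) auto
    qed
    ultimately show False
      using no_cycle[of "(b, a) # p"] by simp
  qed
  then show ?thesis
    using connected_imp_rtrancl[OF H conn] by unfold_locales
qed

section \<open>Unique minimum spanning trees from strict cut inequalities\<close>

text \<open>
  The comparison class of the exchange argument; a minimum over it is a minimum over the
  spanning trees in particular.
\<close>

definition connected_spanning_subgraph :: "'v pair_pre_digraph \<Rightarrow> 'v pair_pre_digraph \<Rightarrow> bool" where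
  "connected_spanning_subgraph H G \<longleftrightarrow> pair_graph H \<and> pverts H = pverts G \<and> parcs H \<subseteq> parcs G \<and>
     (\<forall>u\<in>pverts H. \<forall>v\<in>pverts H. (u, v) \<in> (parcs H)\<^sup>*)"

lemma undirected_spanning_tree_imp_connected_spanning:
  assumes "undirected_spanning_tree H G"
  shows "connected_spanning_subgraph H G"
  using assms connected_imp_rtrancl[of H]
  by (auto simp: undirected_spanning_tree_def undirected_tree_def connected_spanning_subgraph_def
      spanning_def subgraph_def)

lemma finite_connected_spanning_subgraphs:
  assumes "finite (parcs G)"
  shows "finite {H. connected_spanning_subgraph H G}"
proof (rule finite_subset)
  show "{H. connected_spanning_subgraph H G} \<subseteq>
      (\<lambda>A. \<lparr> pverts = pverts G, parcs = A \<rparr>) ` Pow (parcs G)"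
  proof
    fix H assume "H \<in> {H. connected_spanning_subgraph H G}"
    then have "H = \<lparr> pverts = pverts G, parcs = parcs H \<rparr>" "parcs H \<in> Pow (parcs G)"
      by (auto simp: connected_spanning_subgraph_def)
    then show "H \<in> (\<lambda>A. \<lparr> pverts = pverts G, parcs = A \<rparr>) ` Pow (parcs G)"
      by (rule image_eqI)
  qed
qed (use assms in simp)

text \<open>
  The new edge from \<open>a\<close> to \<open>b\<close> restores the connection between \<open>u\<close> and \<open>v\<close>, since \<open>a\<close> is still
  joined to \<open>u\<close> and \<open>b\<close> to \<open>v\<close>.
\<close>

lemma exchange_connected:
  assumes "sym E" and "(u, v) \<in> E" and "a \<in> side E u v" "b \<in> side E v u"
    and "(x, y) \<in> E\<^sup>*"
  shows "(x, y) \<in> (E - {(u, v), (v, u)} \<union> {(a, b), (b, a)})\<^sup>*"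
proof -
  define F where "F = E - {(u, v), (v, u)}"
  define K where "K = F \<union> {(a, b), (b, a)}"
  have sym: "sym (K\<^sup>*)"
    using assms(1) by (intro sym_rtrancl) (auto simp: K_def F_def sym_def)
  have FK: "F\<^sup>* \<subseteq> K\<^sup>*"
    by (intro rtrancl_mono) (auto simp: K_def)
  have "(u, a) \<in> K\<^sup>*" "(v, b) \<in> K\<^sup>*"
    using assms(3,4) FK by (auto simp: side_def F_def insert_commute)
  moreover have "(a, b) \<in> K\<^sup>*"
    by (auto simp: K_def)
  \<comment> \<open>The detour from \<open>u\<close> over \<open>a\<close> and \<open>b\<close> to \<open>v\<close>.\<close>
  ultimately have uv: "(u, v) \<in> K\<^sup>*"
    using sym by (meson rtrancl_trans symD)
  have "E \<subseteq> K\<^sup>*"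
  proof
    fix e assume "e \<in> E"
    then have "e \<in> F \<or> e = (u, v) \<or> e = (v, u)"
      by (auto simp: F_def)
    then show "e \<in> K\<^sup>*"
      using uv symD[OF sym uv] by (auto simp: K_def)
  qed
  then have "E\<^sup>* \<subseteq> K\<^sup>*"
    by (rule rtrancl_subset_rtrancl)
  then show ?thesis
    using assms(5) by (auto simp: K_def F_def)
qed

lemma sum_exchange:
  fixes w :: "'v \<times> 'v \<Rightarrow> real"
  assumes "finite E" "(u, v) \<in> E" "(v, u) \<in> E" "u \<noteq> v" "(a, b) \<notin> E" "(b, a) \<notin> E" "a \<noteq> b"
  shows "sum w (E - {(u, v), (v, u)} \<union> {(a, b), (b, a)}) =
    sum w E - (w (u, v) + w (v, u)) + (w (a, b) + w (b, a))"
proof -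
  have "sum w (E - {(u, v), (v, u)} \<union> {(a, b), (b, a)}) =
      sum w (E - {(u, v), (v, u)}) + sum w {(a, b), (b, a)}"
    using assms by (intro sum.union_disjoint) auto
  moreover have "sum w (E - {(u, v), (v, u)}) = sum w E - sum w {(u, v), (v, u)}"
    using assms by (intro sum_diff) auto
  ultimately show ?thesis
    using assms by simp
qed

text \<open>
  The strict form of the cut property: every tree edge is the only lightest arc across the cut
  that it defines.
\<close>

locale strict_cut_tree = simple_tree T for T :: "'v pair_pre_digraph" +
  fixes G :: "'v pair_pre_digraph" and w :: "'v \<times> 'v \<Rightarrow> real"
  assumes finite_arcs_G: "finite (parcs G)"
    and verts_eq: "pverts T = pverts G" and subset: "parcs T \<subseteq> parcs G"
    and weight_sym: "w (u, v) = w (v, u)"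
    and weight_pos: "(u, v) \<in> parcs G \<Longrightarrow> 0 < w (u, v)"
    and cut_weight: "\<lbrakk>(a, b) \<in> parcs T; (u, v) \<in> parcs G; u \<in> tree_side a b; v \<notin> tree_side a b; (u, v) \<noteq> (a, b)\<rbrakk>
      \<Longrightarrow> w (a, b) < w (u, v)"
begin

text \<open>
  A subgraph that contains the tree properly is heavier than the tree since all weights are
  positive. If the tree edge from \<open>a\<close> to \<open>b\<close> is missing, a path of the subgraph from \<open>a\<close> to \<open>b\<close> supplies an arc
  across the cut of that edge which can be exchanged for it, and the cut inequality makes this
  exchange profitable.
\<close>

lemma cheaper_connected_spanning_subgraph:
  assumes H: "connected_spanning_subgraph H G" and "H \<noteq> T"
  obtains H' where "connected_spanning_subgraph H' G" "total_weight w H' < total_weight w H"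
proof -
  interpret H: pair_graph H
    using H by (simp add: connected_spanning_subgraph_def)
  have verts_H: "pverts H = pverts G" and arcs_H: "parcs H \<subseteq> parcs G"
    and conn_H: "\<And>x y. x \<in> pverts G \<Longrightarrow> y \<in> pverts G \<Longrightarrow> (x, y) \<in> (parcs H)\<^sup>*"
    using H by (auto simp: connected_spanning_subgraph_def)
  show thesis
  proof (cases "parcs T \<subseteq> parcs H")
    case True
    then have "parcs T \<subset> parcs H"
      using \<open>H \<noteq> T\<close> verts_H verts_eq by auto
    then obtain e where e: "e \<in> parcs H - parcs T"
      by blast
    have pos: "0 < w e" if "e \<in> parcs H" for e
      using weight_pos[of "fst e" "snd e"] arcs_H that by auto
    then have "sum w (parcs T) < sum w (parcs H)"
      using True e H.pair_finite_arcs by (intro sum_strict_mono2[of _ _ e]) (auto intro: less_imp_le)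
    moreover have "connected_spanning_subgraph T G"
      unfolding connected_spanning_subgraph_def
      using pair_graph verts_eq subset tree_connected by blast
    ultimately show thesis
      using that by (simp add: total_weight_def)
  next
    case False
    then obtain a b where ab: "(a, b) \<in> parcs T" "(a, b) \<notin> parcs H"
      by auto
    have a: "a \<in> pverts G" and b: "b \<in> pverts G"
      using ab(1) verts_eq by (auto dest: in_arcsD1 in_arcsD2)
    then obtain p where "H.apath a p b"
      using H.rtrancl_imp_apath[OF conn_H[OF a b]] verts_H by metis
    then obtain u v where uv: "(u, v) \<in> parcs H" "u \<in> tree_side a b" "v \<notin> tree_side a b"
      and sides: "a \<in> side (parcs H) u v" "b \<in> side (parcs H) v u"
      using H.apath_crossing_arc[of a p b "tree_side a b"] bridge[OF ab(1)] in_side_refl[of a] by metis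
    define H' where "H' = \<lparr> pverts = pverts G,
      parcs = parcs H - {(u, v), (v, u)} \<union> {(a, b), (b, a)} \<rparr>"
    have ba: "(b, a) \<in> parcs T"
      using ab(1) by (rule arcs_symmetric)
    have verts_H': "pverts H' = pverts G"
      and arcs_H': "parcs H' = parcs H - {(u, v), (v, u)} \<union> {(a, b), (b, a)}"
      by (simp_all add: H'_def)
    have "pair_graph H'"
    proof unfold_locales
      have arc: "x \<in> pverts G \<and> y \<in> pverts G \<and> x \<noteq> y" if "(x, y) \<in> parcs H'" for x y
      proof (cases "(x, y) \<in> parcs H")
        case True
        then show ?thesis
          using H.in_arcsD1 H.in_arcsD2 H.no_loops' verts_H by blast
      next
        case False
        then have "(x, y) = (a, b) \<or> (x, y) = (b, a)"
          using that by (simp add: arcs_H')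
        then show ?thesis
          using a b no_loops'[OF ab(1)] by auto
      qed
      show "fst e \<in> pverts H'" "snd e \<in> pverts H'" "fst e \<noteq> snd e" if "e \<in> parcs H'" for e
        using arc[of "fst e" "snd e"] that by (simp_all add: verts_H')
      show "finite (pverts H')" "finite (parcs H')"
        using H.pair_finite_arcs pair_finite_verts verts_eq by (simp_all add: verts_H' arcs_H')
      show "symmetric (with_proj H')"
        by (auto simp: symmetric_def sym_def arcs_H' dest: H.arcs_symmetric)
    qed
    moreover have "(x, y) \<in> (parcs H')\<^sup>*" if "x \<in> pverts G" "y \<in> pverts G" for x y
      unfolding arcs_H'
      using H.arcs_symmetric uv(1) sides conn_H[OF that]
      by (intro exchange_connected) (auto simp: sym_def)
    moreover have "parcs H' \<subseteq> parcs G"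
      using arcs_H subset ab(1) ba by (auto simp: arcs_H')
    ultimately have "connected_spanning_subgraph H' G"
      unfolding connected_spanning_subgraph_def verts_H' by blast
    moreover have "w (a, b) < w (u, v)"
      using cut_weight[OF ab(1) _ uv(2,3)] uv(1) ab(2) arcs_H by auto
    then have "sum w (parcs H') < sum w (parcs H)"
      unfolding arcs_H'
      using sum_exchange[of "parcs H" u v a b w] uv(1) ab(2) H.arcs_symmetric H.no_loops'[OF uv(1)]
        no_loops'[OF ab(1)] H.pair_finite_arcs weight_sym[of a b] weight_sym[of u v]
      by fastforce
    ultimately show thesis
      using that by (simp add: total_weight_def)
  qed
qed

text \<open>
  A lightest member of the finite class exists, and only the tree cannot be made lighter.
\<close>

theorem unique_minimum_spanning_tree:
  assumes "undirected_spanning_tree T G"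
  shows "minimum_spanning_tree w G H \<longleftrightarrow> H = T"
proof -
  define \<H> where "\<H> = {H. connected_spanning_subgraph H G}"
  have "T \<in> \<H>"
    using assms undirected_spanning_tree_imp_connected_spanning by (simp add: \<H>_def)
  then obtain H\<^sub>0 where H0: "H\<^sub>0 \<in> \<H>" and min: "\<And>K. K \<in> \<H> \<Longrightarrow> total_weight w H\<^sub>0 \<le> total_weight w K"
    using finite_connected_spanning_subgraphs[OF finite_arcs_G]
      ex_min_if_finite[of "total_weight w ` \<H>"] unfolding \<H>_def[symmetric]
    by (auto simp: not_less)
  have T: "K = T" if "K \<in> \<H>" "total_weight w K \<le> total_weight w H\<^sub>0" for K
  proof (rule ccontr)
    assume "K \<noteq> T"
    moreover have "connected_spanning_subgraph K G"
      using that(1) by (simp add: \<H>_def)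
    ultimately obtain K' where "connected_spanning_subgraph K' G" "total_weight w K' < total_weight w K"
      using cheaper_connected_spanning_subgraph by metis
    then show False
      using min[of K'] that(2) by (simp add: \<H>_def)
  qed
  have "H\<^sub>0 = T"
    using T[OF H0] by simp
  show ?thesis
  proof
    assume "minimum_spanning_tree w G H"
    then show "H = T"
      using T[of H] \<open>H\<^sub>0 = T\<close> assms undirected_spanning_tree_imp_connected_spanning
      by (auto simp: minimum_spanning_tree_def \<H>_def)
  next
    assume "H = T"
    then show "minimum_spanning_tree w G H"
      using min \<open>H\<^sub>0 = T\<close> assms undirected_spanning_tree_imp_connected_spanning
      by (auto simp: minimum_spanning_tree_def \<H>_def)
  qed
qed

end

section \<open>Potential drops in a radial flow network\<close>

lemma (in prob_space) indep_var_disjoint_sums: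
  fixes X :: "'i \<Rightarrow> 'a \<Rightarrow> real"
  assumes "indep_vars (\<lambda>_. borel) X I" "A \<inter> B = {}" "A \<subseteq> I" "B \<subseteq> I"
  shows "indep_var borel (\<lambda>\<omega>. \<Sum>i\<in>A. X i \<omega>) borel (\<lambda>\<omega>. \<Sum>i\<in>B. X i \<omega>)"
  using indep_var_compose[OF indep_var_restrict[OF assms],
      of "\<lambda>x. \<Sum>i\<in>A. x i" borel "\<lambda>x. \<Sum>i\<in>B. x i" borel]
  by (simp add: comp_def)

context radial_flow_network
begin

lemma simple_tree_T: "simple_tree T"
  using operational_tree simple_tree_of_undirected_tree by (auto simp: undirected_spanning_tree_def)

end

sublocale radial_flow_network \<subseteq> T: simple_tree T
  by (rule simple_tree_T)

context radial_flow_network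
begin

lemma verts_T [simp]: "pverts T = pverts G"
  using operational_tree by (simp add: undirected_spanning_tree_def spanning_def)

lemma arcs_T: "parcs T \<subseteq> parcs G"
  using operational_tree by (simp add: undirected_spanning_tree_def spanning_def subgraph_def)

lemma side_T_subset: "(a, b) \<in> parcs T \<Longrightarrow> T.tree_side a b \<subseteq> pverts G"
  using T.side_subset_verts[OF T.in_arcsD1[of a b]] by simp

lemma finite_side_T: "(a, b) \<in> parcs T \<Longrightarrow> finite (T.tree_side a b)"
  using finite_subset[OF side_T_subset] pair_finite_verts by blast

text \<open>
  When conservation is summed over a side, the flows between two nodes of that side cancel in pairs
  by antisymmetry, and the only arc that leaves the side is the given one.
\<close>

lemma flow_eq_side_injection:
  assumes ab: "(a, b) \<in> parcs T" and \<omega>: "\<omega> \<in> space M"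
  shows "f a b \<omega> = (\<Sum>x\<in>T.tree_side a b. P x \<omega>)"
proof -
  define A where "A = T.tree_side a b"
  define I where "I = {(x, y) \<in> parcs T. x \<in> A \<and> y \<in> A}"
  have A: "finite A" "A \<subseteq> pverts G"
    using finite_side_T[OF ab] side_T_subset[OF ab] by (auto simp: A_def)
  have fin: "finite {y. (x, y) \<in> parcs T}" for x
    using finite_subset[of "{y. (x, y) \<in> parcs T}" "snd ` parcs T"] T.pair_finite_arcs by force
  have "finite I"
    using finite_subset[of I "parcs T"] T.pair_finite_arcs by (auto simp: I_def)
  have bA: "b \<notin> A"
    using T.bridge[OF ab] by (simp add: A_def)
  \<comment> \<open>The insertion is the boundary of the side: it has no arc out of it but \<open>(a, b)\<close>.\<close>
  have arcs: "Sigma A (\<lambda>x. {y. (x, y) \<in> parcs T}) = insert (a, b) I"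
    using T.leaving_side[OF ab] ab in_side_refl[of a "parcs T" b] by (auto simp: A_def I_def)
  have "(\<Sum>(x, y)\<in>I. f x y \<omega>) = (\<Sum>(x, y)\<in>I. f y x \<omega>)"
    by (rule sum.reindex_bij_witness[of _ prod.swap prod.swap])
      (auto simp: I_def dest: T.arcs_symmetric)
  also have "\<dots> = - (\<Sum>(x, y)\<in>I. f x y \<omega>)"
    unfolding sum_negf[symmetric]
    by (rule sum.cong) (auto simp: I_def flow_antisym[OF _ \<omega>])
  finally have inner: "(\<Sum>(x, y)\<in>I. f x y \<omega>) = 0"
    by simp
  have "(\<Sum>x\<in>A. P x \<omega>) = (\<Sum>x\<in>A. \<Sum>y | (x, y) \<in> parcs T. f x y \<omega>)"
    using A(2) by (intro sum.cong refl flow_conservation[OF _ \<omega>]) auto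
  also have "\<dots> = (\<Sum>(x, y)\<in>insert (a, b) I. f x y \<omega>)"
    using sum.Sigma[of A "\<lambda>x. {y. (x, y) \<in> parcs T}" "\<lambda>x y. f x y \<omega>"] A(1) fin by (simp add: arcs)
  also have "\<dots> = f a b \<omega>"
    using inner bA \<open>finite I\<close> by (simp add: I_def)
  finally show ?thesis
    by (simp add: A_def)
qed

text \<open>
  Centred potentials make covariances plain expectations of products.
\<close>

definition deviation :: "'v \<Rightarrow> 'w \<Rightarrow> real" where
  "deviation a \<omega> = pot a \<omega> - expectation (pot a)"

text \<open>
  The two pairs of nodes need not be adjacent: the same function serves for the drops of single
  edges, for the differences that they add up to, and, with equal pairs, for variances.
\<close>

definition drop_cov :: "'v \<Rightarrow> 'v \<Rightarrow> 'v \<Rightarrow> 'v \<Rightarrow> real" where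
  "drop_cov a b a' b' =
     expectation (\<lambda>\<omega>. (deviation a \<omega> - deviation b \<omega>) * (deviation a' \<omega> - deviation b' \<omega>))"

lemma integrable_deviation: "a \<in> pverts G \<Longrightarrow> integrable M (deviation a)"
  unfolding deviation_def using potential_finite_mean by simp

lemma expectation_deviation: "a \<in> pverts G \<Longrightarrow> expectation (deviation a) = 0"
  unfolding deviation_def using potential_finite_mean by (simp add: prob_space)

lemma integrable_deviation_mult:
  assumes "a \<in> pverts G" "b \<in> pverts G"
  shows "integrable M (\<lambda>\<omega>. deviation a \<omega> * deviation b \<omega>)"
  using assms potential_finite_variance
  by (intro integrable_mult_of_square borel_measurable_integrable integrable_deviation)
    (simp_all add: deviation_def)

lemma integrable_drop_mult:
  assumes "a \<in> pverts G" "b \<in> pverts G" "a' \<in> pverts G" "b' \<in> pverts G"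
  shows "integrable M (\<lambda>\<omega>. (deviation a \<omega> - deviation b \<omega>) * (deviation a' \<omega> - deviation b' \<omega>))"
  using assms by (simp add: algebra_simps integrable_deviation_mult)

lemma drop_cov_commute: "drop_cov a b a' b' = drop_cov a' b' a b"
  by (simp add: drop_cov_def mult.commute)

lemma drop_cov_minus: "drop_cov b a b' a' = drop_cov a b a' b'"
  unfolding drop_cov_def by (simp add: algebra_simps)

lemma drop_cov_swap: "drop_cov a b b' a' = - drop_cov a b a' b'"
  unfolding drop_cov_def Bochner_Integration.integral_minus[symmetric] by (simp add: algebra_simps)

lemma drop_cov_add:
  assumes "a \<in> pverts G" "b \<in> pverts G" "a' \<in> pverts G" "b' \<in> pverts G" "e \<in> pverts G"
  shows "drop_cov a b a' e = drop_cov a b a' b' + drop_cov a b b' e"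
proof -
  have "drop_cov a b a' b' + drop_cov a b b' e =
      expectation (\<lambda>\<omega>. (deviation a \<omega> - deviation b \<omega>) * (deviation a' \<omega> - deviation b' \<omega>) +
        (deviation a \<omega> - deviation b \<omega>) * (deviation b' \<omega> - deviation e \<omega>))"
    unfolding drop_cov_def
    by (rule Bochner_Integration.integral_add[symmetric]; rule integrable_drop_mult; fact)
  then show ?thesis
    by (simp add: drop_cov_def distrib_left[symmetric])
qed

lemma potential_weight_eq_drop_cov: "potential_weight pot (a, b) = drop_cov a b a b"
  unfolding potential_weight_def drop_cov_def deviation_def
  by (auto intro!: Bochner_Integration.integral_cong simp: power2_eq_square algebra_simps)

text \<open>
  The assumption on \<open>r\<close> expresses that \<open>b\<close> is the parent of \<open>a\<close>.
\<close>

lemma deviation_drop: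
  assumes ab: "(a, b) \<in> parcs T" and r: "r \<notin> T.tree_side a b" and \<omega>: "\<omega> \<in> space M"
  shows "deviation a \<omega> - deviation b \<omega> =
    g a b (\<Sum>x\<in>T.tree_side a b. P x \<omega>) - (expectation (pot a) - expectation (pot b))"
proof -
  have "(a, b) \<in> arcs_towards T r"
    using T.arc_towards[OF ab] T.side_reverse[OF ab] r reference_node by simp
  then show ?thesis
    using potential_difference[of a b \<omega>] \<omega> flow_eq_side_injection[OF ab \<omega>]
    by (simp add: deviation_def)
qed

lemma strict_mono_flow_function:
  assumes "(a, b) \<in> parcs T" "r \<notin> T.tree_side a b"
  shows "strict_mono (g a b)"
  using T.arc_towards[of a b r] T.side_reverse[of a b] assms reference_node
  by (intro flow_function_strict_mono) simp

text \<open>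
  Both edges point towards the reference node and the second is the first or lies downstream of it.
  Its flow is that of the first plus the independent injections at the other nodes of its subtree.
\<close>

lemma drop_cov_below_nonneg:
  assumes ab: "(a, b) \<in> parcs T" and ab': "(a', b') \<in> parcs T"
    and nested: "T.tree_side a b \<subseteq> T.tree_side a' b'" and r: "r \<notin> T.tree_side a' b'"
  shows "0 \<le> drop_cov a b a' b'"
proof -
  define X where "X \<omega> = (\<Sum>x\<in>T.tree_side a b. P x \<omega>)" for \<omega>
  define R where "R \<omega> = (\<Sum>x\<in>T.tree_side a' b' - T.tree_side a b. P x \<omega>)" for \<omega>
  define g1 where "g1 s = g a b s - (expectation (pot a) - expectation (pot b))" for s
  define g2 where "g2 s = g a' b' s - (expectation (pot a') - expectation (pot b'))" for s
  have verts: "a \<in> pverts G" "b \<in> pverts G" "a' \<in> pverts G" "b' \<in> pverts G"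
    using ab ab' arcs_T in_arcsD1 in_arcsD2 by blast+
  have r': "r \<notin> T.tree_side a b"
    using nested r by auto
  have indep: "indep_var borel X borel R"
    unfolding X_def R_def using side_T_subset[OF ab] side_T_subset[OF ab'] r r'
    by (intro indep_var_disjoint_sums[OF injections_indep]) auto
  have mono: "mono g1" "mono g2"
    using strict_mono_mono[OF strict_mono_flow_function[OF ab r']]
      strict_mono_mono[OF strict_mono_flow_function[OF ab' r]]
    by (auto simp: g1_def g2_def mono_def)
  have X: "deviation a \<omega> - deviation b \<omega> = g1 (X \<omega>)" if "\<omega> \<in> space M" for \<omega>
    using deviation_drop[OF ab r' that] by (simp add: g1_def X_def)
  have XR: "deviation a' \<omega> - deviation b' \<omega> = g2 (X \<omega> + R \<omega>)" if "\<omega> \<in> space M" for \<omega>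
    using deviation_drop[OF ab' r that] sum.subset_diff[OF nested finite_side_T[OF ab'], of "\<lambda>x. P x \<omega>"]
    by (simp add: g2_def X_def R_def add.commute)
  have "integrable M (\<lambda>\<omega>. g1 (X \<omega>))"
    using Bochner_Integration.integrable_diff[OF integrable_deviation[OF verts(1)] integrable_deviation[OF verts(2)]]
    by (subst (asm) Bochner_Integration.integrable_cong[OF refl X])
  moreover have "integrable M (\<lambda>\<omega>. g2 (X \<omega> + R \<omega>))"
    using Bochner_Integration.integrable_diff[OF integrable_deviation[OF verts(3)] integrable_deviation[OF verts(4)]]
    by (subst (asm) Bochner_Integration.integrable_cong[OF refl XR])
  moreover have "integrable M (\<lambda>\<omega>. g1 (X \<omega>) * g2 (X \<omega> + R \<omega>))"
    using integrable_drop_mult[OF verts]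
    by (subst (asm) Bochner_Integration.integrable_cong[OF refl]) (auto simp: X XR)
  ultimately have "expectation (\<lambda>\<omega>. g1 (X \<omega>)) * expectation (\<lambda>\<omega>. g2 (X \<omega> + R \<omega>))
      \<le> expectation (\<lambda>\<omega>. g1 (X \<omega>) * g2 (X \<omega> + R \<omega>))"
    by (rule expectation_mult_mono_ge[OF indep mono])
  moreover have "expectation (\<lambda>\<omega>. g1 (X \<omega>)) = expectation (\<lambda>\<omega>. deviation a \<omega> - deviation b \<omega>)"
    by (rule Bochner_Integration.integral_cong) (simp_all add: X)
  then have "expectation (\<lambda>\<omega>. g1 (X \<omega>)) = 0"
    using verts by (simp add: integrable_deviation expectation_deviation)
  moreover have "expectation (\<lambda>\<omega>. g1 (X \<omega>) * g2 (X \<omega> + R \<omega>)) = drop_cov a b a' b'"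
    unfolding drop_cov_def by (rule Bochner_Integration.integral_cong) (simp_all add: X XR)
  ultimately show ?thesis
    by simp
qed

text \<open>
  Both edges point towards the reference node, with disjoint subtrees: the drops depend on disjoint
  sets of injections.
\<close>

lemma drop_cov_opposite_eq_0:
  assumes ab: "(a, b) \<in> parcs T" and ab': "(a', b') \<in> parcs T"
    and disjoint: "T.tree_side a b \<inter> T.tree_side a' b' = {}" and r: "r \<notin> T.tree_side a b" "r \<notin> T.tree_side a' b'"
  shows "drop_cov a b a' b' = 0"
proof -
  define X where "X \<omega> = (\<Sum>x\<in>T.tree_side a b. P x \<omega>)" for \<omega>
  define Y where "Y \<omega> = (\<Sum>x\<in>T.tree_side a' b'. P x \<omega>)" for \<omega>
  define g1 where "g1 s = g a b s - (expectation (pot a) - expectation (pot b))" for s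
  define g2 where "g2 s = g a' b' s - (expectation (pot a') - expectation (pot b'))" for s
  have verts: "a \<in> pverts G" "b \<in> pverts G" "a' \<in> pverts G" "b' \<in> pverts G"
    using ab ab' arcs_T in_arcsD1 in_arcsD2 by blast+
  have "mono g1" "mono g2"
    using strict_mono_mono[OF strict_mono_flow_function[OF ab r(1)]]
      strict_mono_mono[OF strict_mono_flow_function[OF ab' r(2)]]
    by (auto simp: g1_def g2_def mono_def)
  then have "g1 \<in> borel_measurable borel" "g2 \<in> borel_measurable borel"
    by (simp_all add: borel_measurable_mono)
  moreover have "indep_var borel X borel Y"
    unfolding X_def Y_def using side_T_subset[OF ab] side_T_subset[OF ab'] r disjoint
    by (intro indep_var_disjoint_sums[OF injections_indep]) auto
  ultimately have indep: "indep_var borel (\<lambda>\<omega>. g1 (X \<omega>)) borel (\<lambda>\<omega>. g2 (Y \<omega>))"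
    using indep_var_compose[of borel X borel Y g1 borel g2 borel] by (simp add: comp_def)
  have X: "deviation a \<omega> - deviation b \<omega> = g1 (X \<omega>)" if "\<omega> \<in> space M" for \<omega>
    using deviation_drop[OF ab r(1) that] by (simp add: g1_def X_def)
  have Y: "deviation a' \<omega> - deviation b' \<omega> = g2 (Y \<omega>)" if "\<omega> \<in> space M" for \<omega>
    using deviation_drop[OF ab' r(2) that] by (simp add: g2_def Y_def)
  have int: "integrable M (\<lambda>\<omega>. g1 (X \<omega>))" "integrable M (\<lambda>\<omega>. g2 (Y \<omega>))"
    using Bochner_Integration.integrable_diff[OF integrable_deviation[OF verts(1)] integrable_deviation[OF verts(2)]]
      Bochner_Integration.integrable_diff[OF integrable_deviation[OF verts(3)] integrable_deviation[OF verts(4)]]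
    by (simp_all add: X Y cong: Bochner_Integration.integrable_cong)
  have "drop_cov a b a' b' = expectation (\<lambda>\<omega>. g1 (X \<omega>) * g2 (Y \<omega>))"
    unfolding drop_cov_def by (rule Bochner_Integration.integral_cong) (simp_all add: X Y)
  also have "\<dots> = expectation (\<lambda>\<omega>. g1 (X \<omega>)) * expectation (\<lambda>\<omega>. g2 (Y \<omega>))"
    using indep_var_lebesgue_integral[OF indep int] .
  also have "expectation (\<lambda>\<omega>. g1 (X \<omega>)) = expectation (\<lambda>\<omega>. deviation a \<omega> - deviation b \<omega>)"
    by (rule Bochner_Integration.integral_cong) (simp_all add: X)
  also have "\<dots> = 0"
    using verts by (simp add: integrable_deviation expectation_deviation)
  finally show ?thesis
    by simp
qed

text \<open>
  The nesting of the sides says that the two edges are passed in this order and in these directions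
  by a path. The reference node may lie ahead of both edges, behind both, or between them. Reversing
  both edges turns the second case into the first; in the third, reversing only the second edge
  leads to disjoint subtrees.
\<close>

lemma drop_cov_nested_nonneg:
  assumes ab: "(a, b) \<in> parcs T" and ab': "(a', b') \<in> parcs T" and nested: "T.tree_side a b \<subseteq> T.tree_side a' b'"
  shows "0 \<le> drop_cov a b a' b'"
proof -
  note rev = T.side_reverse[OF ab] T.side_reverse[OF ab']
  consider "r \<notin> T.tree_side a' b'" | "r \<in> T.tree_side a b" | "r \<in> T.tree_side a' b'" "r \<notin> T.tree_side a b"
    by blast
  then show ?thesis
  proof cases
    case 1
    with assms show ?thesis by (rule drop_cov_below_nonneg)
  next
    case 2
    have "0 \<le> drop_cov b' a' b a"
      using rev nested 2 by (intro drop_cov_below_nonneg T.arcs_symmetric[OF ab] T.arcs_symmetric[OF ab']) auto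
    then show ?thesis
      using drop_cov_minus[of b' a' b a] drop_cov_commute[of a b a' b'] by simp
  next
    case 3
    have "drop_cov a b b' a' = 0"
      using rev nested 3 by (intro drop_cov_opposite_eq_0 ab T.arcs_symmetric[OF ab']) auto
    then show ?thesis
      using drop_cov_swap[of a b b' a'] by simp
  qed
qed

text \<open>
  Reversing the edge does not change the variance, so \<open>b\<close> may be taken as the parent of \<open>a\<close>. The
  injection at \<open>a\<close> then contributes a density to the flow, independent of the rest of the flow.
\<close>

lemma drop_variance_pos:
  assumes ab: "(a, b) \<in> parcs T"
  shows "0 < drop_cov a b a b"
proof -
  have pos: "0 < drop_cov a b a b" if ab: "(a, b) \<in> parcs T" and r: "r \<notin> T.tree_side a b" for a b
  proof -
    define R where "R \<omega> = (\<Sum>x\<in>T.tree_side a b - {a}. P x \<omega>)" for \<omega>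
    define m where "m = expectation (pot a) - expectation (pot b)"
    have a: "a \<in> T.tree_side a b"
      by (rule in_side_refl)
    have sum: "(\<Sum>x\<in>T.tree_side a b. P x \<omega>) = R \<omega> + P a \<omega>" for \<omega>
      using sum.remove[OF finite_side_T[OF ab] a, of "\<lambda>x. P x \<omega>"] by (simp add: R_def)
    have "indep_var borel R borel (\<lambda>\<omega>. \<Sum>x\<in>{a}. P x \<omega>)"
      unfolding R_def using side_T_subset[OF ab] r a
      by (intro indep_var_disjoint_sums[OF injections_indep]) auto
    moreover have "a \<in> pverts G - {r}"
      using side_T_subset[OF ab] r a by auto
    then obtain D where "distributed M lborel (P a) D"
      using injections_density by blast
    ultimately have atomless: "AE \<omega> in M. R \<omega> + P a \<omega> \<noteq> k" for k
      by (intro AE_add_indep_neq) auto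
    have drop: "deviation a \<omega> - deviation b \<omega> = g a b (R \<omega> + P a \<omega>) - m" if "\<omega> \<in> space M" for \<omega>
      using deviation_drop[OF ab r that] by (simp add: m_def sum)
    have verts: "a \<in> pverts G" "b \<in> pverts G"
      using ab arcs_T in_arcsD1 in_arcsD2 by blast+
    have "integrable M (\<lambda>\<omega>. (g a b (R \<omega> + P a \<omega>) - m)\<^sup>2)"
      using integrable_drop_mult[OF verts verts]
      by (simp add: drop power2_eq_square cong: Bochner_Integration.integrable_cong)
    then have "0 < expectation (\<lambda>\<omega>. (g a b (R \<omega> + P a \<omega>) - m)\<^sup>2)"
      using strict_mono_imp_inj_on[OF strict_mono_flow_function[OF ab r]] atomless
      by (intro variance_inj_atomless_pos)
    also have "\<dots> = drop_cov a b a b"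
      unfolding drop_cov_def by (rule Bochner_Integration.integral_cong) (simp_all add: drop power2_eq_square)
    finally show ?thesis .
  qed
  show ?thesis
  proof (cases "r \<in> T.tree_side a b")
    case True
    then have "0 < drop_cov b a b a"
      using T.side_reverse[OF ab] by (intro pos T.arcs_symmetric[OF ab]) simp
    then show ?thesis
      using drop_cov_minus[of b a b a] by simp
  next
    case False
    with ab show ?thesis by (rule pos)
  qed
qed

lemma drop_cov_apath_nonneg:
  assumes ab: "(a, b) \<in> parcs T" and "T.apath a' p v"
    and "\<And>x y. (x, y) \<in> set p \<Longrightarrow> T.tree_side a b \<subseteq> T.tree_side x y"
  shows "0 \<le> drop_cov a b a' v"
  using assms(2-)
proof (induction p arbitrary: a')
  case Nil
  then show ?case by (simp add: T.apath_Nil_iff drop_cov_def)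
next
  case (Cons e p)
  obtain y where e: "e = (a', y)" "(a', y) \<in> parcs T" "T.apath y p v"
    using Cons.prems(1) by (cases e) (auto simp: T.apath_Cons_iff)
  have "v \<in> pverts G"
    using T.awalk_last_in_verts[OF T.awalkI_apath[OF e(3)]] by simp
  then have "drop_cov a b a' v = drop_cov a b a' y + drop_cov a b y v"
    using ab e(2) arcs_T in_arcsD1 in_arcsD2 by (intro drop_cov_add) blast+
  moreover have "0 \<le> drop_cov a b a' y"
    using Cons.prems(2)[of a' y] e by (intro drop_cov_nested_nonneg ab) auto
  moreover have "0 \<le> drop_cov a b y v"
    using Cons.prems(2) e(3) by (intro Cons.IH) auto
  ultimately show ?case
    by simp
qed

text \<open>
  Splitting off the first drop of the path leaves a mixed term, its covariance with the remaining
  potential difference. It is nonnegative because the sides along the path are nested.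
\<close>

theorem path_weight_le_potential_weight:
  assumes "T.apath u p v"
  shows "(\<Sum>e\<leftarrow>p. potential_weight pot e) \<le> potential_weight pot (u, v)"
  using assms
proof (induction p arbitrary: u)
  case Nil
  then show ?case by (simp add: T.apath_Nil_iff potential_weight_eq_drop_cov drop_cov_def)
next
  case (Cons e p)
  obtain x where e: "e = (u, x)" "(u, x) \<in> parcs T" "T.apath x p v"
    using Cons.prems(1) by (cases e) (auto simp: T.apath_Cons_iff)
  have verts: "u \<in> pverts G" "x \<in> pverts G" "v \<in> pverts G"
    using T.awalk_last_in_verts[OF T.awalkI_apath[OF e(3)]] e(2) arcs_T in_arcsD1 in_arcsD2
    by auto
  have cross: "0 \<le> drop_cov u x x v"
    using T.apath_sides_increase Cons.prems e by (intro drop_cov_apath_nonneg[OF e(2,3)]) auto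
  have "drop_cov u v u v = drop_cov u v u x + drop_cov u v x v"
    using verts by (intro drop_cov_add)
  also have "drop_cov u v u x = drop_cov u x u x + drop_cov u x x v"
    using drop_cov_add[of u x u x v] verts by (simp add: drop_cov_commute[of u v])
  also have "drop_cov u v x v = drop_cov u x x v + drop_cov x v x v"
    using drop_cov_add[of x v u x v] verts
    by (simp add: drop_cov_commute[of u v x v] drop_cov_commute[of x v u x])
  finally have "potential_weight pot (u, x) + potential_weight pot (x, v) \<le> potential_weight pot (u, v)"
    using cross by (simp add: potential_weight_eq_drop_cov)
  then show ?case
    using Cons.IH[OF e(3)] e(1) by simp
qed

lemma path_weight_pos:
  assumes "set p \<subseteq> parcs T" "p \<noteq> []"
  shows "0 < (\<Sum>e\<leftarrow>p. potential_weight pot e)"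
  using assms(2,1)
proof (induction p rule: list_nonempty_induct)
  case (single e)
  then show ?case
    using drop_variance_pos by (cases e) (auto simp: potential_weight_eq_drop_cov)
next
  case (cons e p)
  then show ?case
    using drop_variance_pos by (cases e) (auto simp: potential_weight_eq_drop_cov intro: add_pos_pos)
qed

text \<open>
  The tree path between the ends of the crossing arc contains the tree edge of the cut, and it
  consists of more than this edge because the crossing arc is a different one.
\<close>

lemma potential_weight_strict_cut:
  assumes ab: "(a, b) \<in> parcs T" and uv: "(u, v) \<in> parcs G"
    and cut: "u \<in> T.tree_side a b" "v \<notin> T.tree_side a b" and "(u, v) \<noteq> (a, b)"
  shows "potential_weight pot (a, b) < potential_weight pot (u, v)"
proof -
  obtain p where p: "T.apath u p v"
    using T.exists_apath[of u v] uv by (auto dest: in_arcsD1 in_arcsD2)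
  obtain p1 p2 where p12: "p = p1 @ (a, b) # p2"
    using T.crossing_arc_in_apath[OF ab p cut] split_list by metis
  have sub: "set p1 \<subseteq> parcs T" "set p2 \<subseteq> parcs T"
    using T.awalkI_apath[OF p] p12 by (auto simp: T.awalk_def)
  have "p1 \<noteq> [] \<or> p2 \<noteq> []"
    using p p12 \<open>(u, v) \<noteq> (a, b)\<close> by (auto simp: T.apath_Cons_iff T.apath_Nil_iff)
  then have "potential_weight pot (a, b) < (\<Sum>e\<leftarrow>p. potential_weight pot e)"
    using path_weight_pos[OF sub(1)] path_weight_pos[OF sub(2)] p12
    by (cases "p1 = []"; cases "p2 = []") auto
  also have "\<dots> \<le> potential_weight pot (u, v)"
    by (rule path_weight_le_potential_weight[OF p])
  finally show ?thesis .
qed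

lemma potential_weight_pos:
  assumes "u \<in> pverts G" "v \<in> pverts G" "u \<noteq> v"
  shows "0 < potential_weight pot (u, v)"
proof -
  obtain p where p: "T.apath u p v"
    using T.exists_apath[of u v] assms by auto
  have "p \<noteq> []"
    using p assms(3) by (auto simp: T.apath_Nil_iff)
  then have "0 < (\<Sum>e\<leftarrow>p. potential_weight pot e)"
    using T.awalkI_apath[OF p] by (intro path_weight_pos) (auto simp: T.awalk_def)
  also have "\<dots> \<le> potential_weight pot (u, v)"
    by (rule path_weight_le_potential_weight[OF p])
  finally show ?thesis .
qed

lemma strict_cut_tree_potential_weight: "strict_cut_tree T G (potential_weight pot)"
proof unfold_locales
  show "potential_weight pot (u, v) = potential_weight pot (v, u)" for u v
    using drop_cov_minus[of u v u v] by (simp add: potential_weight_eq_drop_cov)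
  show "0 < potential_weight pot (u, v)" if "(u, v) \<in> parcs G" for u v
    using that in_arcsD1 in_arcsD2 no_loops' by (intro potential_weight_pos) blast+
  show "potential_weight pot (a, b) < potential_weight pot (u, v)"
    if "(a, b) \<in> parcs T" "(u, v) \<in> parcs G" "u \<in> T.tree_side a b" "v \<notin> T.tree_side a b" "(u, v) \<noteq> (a, b)"
    for a b u v
    using that by (rule potential_weight_strict_cut)
qed (use arcs_T in auto)

end

theorem theorem3:
  fixes M :: "'w measure"
    and G T :: "'v pair_pre_digraph"
    and r :: 'v
    and P :: "'v \<Rightarrow> 'w \<Rightarrow> real"
    and f :: "'v \<Rightarrow> 'v \<Rightarrow> 'w \<Rightarrow> real"
    and g :: "'v \<Rightarrow> 'v \<Rightarrow> real \<Rightarrow> real"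
    and pot :: "'v \<Rightarrow> 'w \<Rightarrow> real"
    and c :: real
  assumes "radial_flow_network M G T r P f g pot c"
  shows "minimum_spanning_tree (prob_space.potential_weight M pot) G T \<and>
    (\<forall>H. minimum_spanning_tree (prob_space.potential_weight M pot) G H \<longrightarrow> H = T)"
proof -
  interpret radial_flow_network M G T r P f g pot c
    by fact
  show ?thesis
    using strict_cut_tree.unique_minimum_spanning_tree[OF strict_cut_tree_potential_weight operational_tree]
    by simp
qed

end
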